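(* For all odd primes $p$ and $q$, the group $Q_8\times\mathbb{Z}_{pq}$ is not a Schur group.
   Context: Notation: $\mathbb{Z}_n$ is the cyclic group of order $n$; $Q_8$ is the quaternion group of order $8$. The primes $p$ and $q$ are allowed to be equal. Let $G$ be a finite group with identity $e$. For $X\subseteq G$ put $\underline{X}=\sum_{x\in X}x\in\mathbb{Z}G$ and $X^{-1}=\{x^{-1}:x\in X\}$. A subring $\mathcal{A}\subseteq\mathbb{Z}G$ is an S-ring over $G$ if there is a partition $\mathcal{S}$ of $G$ such that (1) $\{e\}\in\mathcal{S}$; (2) $X\in\mathcal{S}$ implies $X^{-1}\in\mathcal{S}$; (3) $\mathcal{A}=\mathrm{Span}_{\mathbb{Z}}\{\underline{X}:X\in\mathcal{S}\}$. Let $G_r\leq\mathrm{Sym}(G)$ be the group of right translations of $G$. For $K\leq \mathrm{Sym}(G)$ with $K\geq G_r$, the $\mathbb{Z}$-module $V(K,G)=\mathrm{Span}_{\mathbb{Z}}\{\underline{X}: X \text{ is an orbit of } K_e \text{ on } G\}$, where $K_e$ is the stabilizer of $e$ in $K$, is an S-ring over $G$. An S-ring $\mathcal{A}$ over $G$ is schurian if $\mathcal{A}=V(K,G)$ for some $K$ with $G_r\leq K\leq\mathrm{Sym}(G)$. The group $G$ is a Schur group if every S-ring over $G$ is schurian. *)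

theory Defs
  imports
    "HOL-Algebra.Group_Action"
    "HOL-Algebra.Elementary_Groups"
    "HOL-Algebra.Subrings"
    "HOL-Library.Disjoint_Sets"
    "HOL-Computational_Algebra.Primes"
begin

(* Elements of the integral group ring of a finite group are functions from the group
   to the integers, extended by 0 outside the carrier. *)
definition int_group_ring :: "('a, 'b) monoid_scheme \<Rightarrow> ('a \<Rightarrow> int) ring" where
  "int_group_ring G =
    \<lparr>carrier = {f. \<forall>x. x \<notin> carrier G \<longrightarrow> f x = 0},
     monoid.mult = (\<lambda>f h z. if z \<in> carrier G
        then \<Sum>x\<in>carrier G. f x * h (inv\<^bsub>G\<^esub> x \<otimes>\<^bsub>G\<^esub> z) else 0),
     one = (\<lambda>x. of_bool (x = \<one>\<^bsub>G\<^esub>)),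
     zero = (\<lambda>x. 0),
     add = (\<lambda>f h x. f x + h x)\<rparr>"

definition simple_quantity :: "'a set \<Rightarrow> 'a \<Rightarrow> int" where
  "simple_quantity X = (\<lambda>x. of_bool (x \<in> X))"

(* Integer span of a finite set of functions. *)
definition int_span :: "('a \<Rightarrow> int) set \<Rightarrow> ('a \<Rightarrow> int) set" where
  "int_span F = {(\<lambda>x. \<Sum>f\<in>F. c f * f x) | c. True}"

definition is_S_ring :: "('a, 'b) monoid_scheme \<Rightarrow> ('a \<Rightarrow> int) set \<Rightarrow> bool" where
  "is_S_ring G A \<longleftrightarrow> subring A (int_group_ring G) \<and>
    (\<exists>P. partition_on (carrier G) P \<and>
         {\<one>\<^bsub>G\<^esub>} \<in> P \<and>
         (\<forall>X\<in>P. m_inv G ` X \<in> P) \<and>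
         A = int_span (simple_quantity ` P))"

definition right_translations :: "('a, 'b) monoid_scheme \<Rightarrow> ('a \<Rightarrow> 'a) set" where
  "right_translations G = {(\<lambda>x\<in>carrier G. x \<otimes>\<^bsub>G\<^esub> g) | g. g \<in> carrier G}"

definition point_stabilizer ::
    "('a, 'b) monoid_scheme \<Rightarrow> ('a \<Rightarrow> 'a) set \<Rightarrow> ('a \<Rightarrow> 'a) set" where
  "point_stabilizer G K =
    stabilizer (BijGroup (carrier G)\<lparr>carrier := K\<rparr>) (\<lambda>f. f) \<one>\<^bsub>G\<^esub>"

(* The module V(K, G). *)
definition transitivity_module ::
    "('a, 'b) monoid_scheme \<Rightarrow> ('a \<Rightarrow> 'a) set \<Rightarrow> ('a \<Rightarrow> int) set" where
  "transitivity_module G K = int_span (simple_quantity `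
     orbits (BijGroup (carrier G)\<lparr>carrier := point_stabilizer G K\<rparr>) (carrier G) (\<lambda>f. f))"

definition schurian :: "('a, 'b) monoid_scheme \<Rightarrow> ('a \<Rightarrow> int) set \<Rightarrow> bool" where
  "schurian G A \<longleftrightarrow>
    (\<exists>K. subgroup K (BijGroup (carrier G)) \<and> right_translations G \<subseteq> K \<and>
         A = transitivity_module G K)"

(* Meant for finite groups G only. *)
definition Schur_group :: "('a, 'b) monoid_scheme \<Rightarrow> bool" where
  "Schur_group G \<longleftrightarrow> (\<forall>A. is_S_ring G A \<longrightarrow> schurian G A)"

type_synonym quaternion = "int \<times> int \<times> int \<times> int"

(* (a, b, c, d) stands for a + b i + c j + d k. *)
fun hamilton_mult :: "quaternion \<Rightarrow> quaternion \<Rightarrow> quaternion" where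
  "hamilton_mult (a, b, c, d) (a', b', c', d') =
    (a * a' - b * b' - c * c' - d * d',
     a * b' + b * a' + c * d' - d * c',
     a * c' - b * d' + c * a' + d * b',
     a * d' + b * c' - c * b' + d * a')"

definition Q8 :: "quaternion monoid" where
  "Q8 = \<lparr>carrier = {(1, 0, 0, 0), (-1, 0, 0, 0), (0, 1, 0, 0), (0, -1, 0, 0),
                   (0, 0, 1, 0), (0, 0, -1, 0), (0, 0, 0, 1), (0, 0, 0, -1)},
         monoid.mult = hamilton_mult,
         one = (1, 0, 0, 0)\<rparr>"

lemma group_Q8: "group Q8"
proof (rule groupI)
  fix x y z
  assume "x \<in> carrier Q8" "y \<in> carrier Q8" "z \<in> carrier Q8"
  show "x \<otimes>\<^bsub>Q8\<^esub> y \<otimes>\<^bsub>Q8\<^esub> z = x \<otimes>\<^bsub>Q8\<^esub> (y \<otimes>\<^bsub>Q8\<^esub> z)"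
    by (cases x; cases y; cases z) (simp add: Q8_def algebra_simps)
qed (auto simp: Q8_def)

lemma order_Q8: "order Q8 = 8"
  by (simp add: Q8_def order_def)

lemma ring_int_group_ring:
  assumes "group G" "finite (carrier G)"
  shows "ring (int_group_ring G)"
proof -
  interpret group G by fact
  let ?R = "int_group_ring G"
  have shift: "(\<Sum>y\<in>carrier G. F (inv\<^bsub>G\<^esub> x \<otimes>\<^bsub>G\<^esub> y)) = (\<Sum>y\<in>carrier G. F y)"
    if "x \<in> carrier G" for x and F :: "'a \<Rightarrow> int"
    by (rule sum.reindex_bij_witness[where i = "\<lambda>y. x \<otimes>\<^bsub>G\<^esub> y" and j = "\<lambda>y. inv\<^bsub>G\<^esub> x \<otimes>\<^bsub>G\<^esub> y"])
      (use that in \<open>auto simp: m_assoc[symmetric]\<close>)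
  show ?thesis
  proof (rule ringI)
    show "abelian_group ?R"
    proof (rule abelian_groupI)
      fix f assume "f \<in> carrier ?R"
      then show "\<exists>h\<in>carrier ?R. h \<oplus>\<^bsub>?R\<^esub> f = \<zero>\<^bsub>?R\<^esub>"
        by (intro bexI[where x = "\<lambda>x. - f x"]) (auto simp: int_group_ring_def)
    qed (auto simp: int_group_ring_def)
    show "monoid ?R"
    proof (rule monoidI)
      fix f g h assume fgh: "f \<in> carrier ?R" "g \<in> carrier ?R" "h \<in> carrier ?R"
      have "(\<Sum>x\<in>carrier G. (\<Sum>y\<in>carrier G. f y * g (inv\<^bsub>G\<^esub> y \<otimes>\<^bsub>G\<^esub> x)) * h (inv\<^bsub>G\<^esub> x \<otimes>\<^bsub>G\<^esub> z))
          = (\<Sum>y\<in>carrier G. f y * (\<Sum>x\<in>carrier G. g x * h (inv\<^bsub>G\<^esub> x \<otimes>\<^bsub>G\<^esub> (inv\<^bsub>G\<^esub> y \<otimes>\<^bsub>G\<^esub> z))))"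
        if z: "z \<in> carrier G" for z
      proof -
        have "(\<Sum>x\<in>carrier G. g x * h (inv\<^bsub>G\<^esub> x \<otimes>\<^bsub>G\<^esub> (inv\<^bsub>G\<^esub> y \<otimes>\<^bsub>G\<^esub> z)))
            = (\<Sum>x\<in>carrier G. g (inv\<^bsub>G\<^esub> y \<otimes>\<^bsub>G\<^esub> x) * h (inv\<^bsub>G\<^esub> x \<otimes>\<^bsub>G\<^esub> z))"
          if y: "y \<in> carrier G" for y
        proof -
          have "inv\<^bsub>G\<^esub> (inv\<^bsub>G\<^esub> y \<otimes>\<^bsub>G\<^esub> x) \<otimes>\<^bsub>G\<^esub> (inv\<^bsub>G\<^esub> y \<otimes>\<^bsub>G\<^esub> z) = inv\<^bsub>G\<^esub> x \<otimes>\<^bsub>G\<^esub> z"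
            if "x \<in> carrier G" for x
          proof -
            have "inv\<^bsub>G\<^esub> (inv\<^bsub>G\<^esub> y \<otimes>\<^bsub>G\<^esub> x) = inv\<^bsub>G\<^esub> x \<otimes>\<^bsub>G\<^esub> y"
              using that y by (simp add: inv_mult_group)
            then show ?thesis using that y z
              by (simp add: m_assoc) (simp add: m_assoc[symmetric])
          qed
          then show ?thesis
            by (subst shift[OF y, symmetric]) (auto intro!: sum.cong)
        qed
        then have "(\<Sum>y\<in>carrier G. f y * (\<Sum>x\<in>carrier G. g x * h (inv\<^bsub>G\<^esub> x \<otimes>\<^bsub>G\<^esub> (inv\<^bsub>G\<^esub> y \<otimes>\<^bsub>G\<^esub> z))))
            = (\<Sum>y\<in>carrier G. \<Sum>x\<in>carrier G. f y * (g (inv\<^bsub>G\<^esub> y \<otimes>\<^bsub>G\<^esub> x) * h (inv\<^bsub>G\<^esub> x \<otimes>\<^bsub>G\<^esub> z)))"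
          by (simp add: sum_distrib_left)
        also have "\<dots> = (\<Sum>x\<in>carrier G. \<Sum>y\<in>carrier G. f y * (g (inv\<^bsub>G\<^esub> y \<otimes>\<^bsub>G\<^esub> x) * h (inv\<^bsub>G\<^esub> x \<otimes>\<^bsub>G\<^esub> z)))"
          by (rule sum.swap)
        finally show ?thesis
          by (simp add: sum_distrib_right mult.assoc)
      qed
      then show "f \<otimes>\<^bsub>?R\<^esub> g \<otimes>\<^bsub>?R\<^esub> h = f \<otimes>\<^bsub>?R\<^esub> (g \<otimes>\<^bsub>?R\<^esub> h)"
        by (auto simp: int_group_ring_def fun_eq_iff cong: sum.cong)
    next
      fix f assume f: "f \<in> carrier ?R"
      show "\<one>\<^bsub>?R\<^esub> \<otimes>\<^bsub>?R\<^esub> f = f"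
        using f assms(2) by (auto simp: int_group_ring_def fun_eq_iff of_bool_def if_distrib[of "\<lambda>t. t * _"] cong: if_cong)
      have "inv\<^bsub>G\<^esub> x \<otimes>\<^bsub>G\<^esub> z = \<one>\<^bsub>G\<^esub> \<longleftrightarrow> x = z" if "x \<in> carrier G" "z \<in> carrier G" for x z
        using that by (metis inv_closed inv_equality inv_inv l_inv)
      then have "(\<Sum>x\<in>carrier G. f x * of_bool (inv\<^bsub>G\<^esub> x \<otimes>\<^bsub>G\<^esub> z = \<one>\<^bsub>G\<^esub>))
          = (\<Sum>x\<in>carrier G. if x = z then f x else 0)" if "z \<in> carrier G" for z
        using that by (intro sum.cong) auto
      then show "f \<otimes>\<^bsub>?R\<^esub> \<one>\<^bsub>?R\<^esub> = f"
        using f assms(2) by (auto simp: int_group_ring_def fun_eq_iff)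
    qed (auto simp: int_group_ring_def)
  qed (auto simp: int_group_ring_def fun_eq_iff sum.distrib algebra_simps)
qed

end

theory Submission
  imports Defs
begin

text \<open>
  Let \<open>C\<close> be the cyclic group of order \<open>pq\<close>, written additively, \<open>P \<le> C\<close> its subgroup of order \<open>p\<close>,
  and let \<open>\<sigma>\<close> be the automorphism of \<open>Q\<^sub>8 \<times> C\<close> that maps \<open>i\<close> to \<open>-i\<close>, exchanges \<open>j\<close> and \<open>k\<close> and
  inverts \<open>C\<close>. Consider the partition of \<open>Q\<^sub>8 \<times> C\<close> into the sets \<open>H w \<union> H \<sigma>(w)\<close>, where the normal
  subgroup \<open>H\<close> depends on \<open>w = (u, c)\<close>: it is trivial if \<open>u \<in> \<langle>i\<rangle>\<close> and \<open>c \<in> P\<close>, it is \<open>P\<close> if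
  \<open>u \<in> \<langle>i\<rangle>\<close> and \<open>c \<notin> P\<close>, it is \<open>\<langle>i\<rangle>\<close> if \<open>u \<notin> \<langle>i\<rangle>\<close> and \<open>c \<in> P\<close>, and it is \<open>{\<plusminus>1} \<times> P\<close> otherwise.
  This is an S-ring, a generalized wreath product of schurian S-rings over \<open>\<langle>i\<rangle> \<times> C\<close> and
  \<open>Q\<^sub>8/{\<plusminus>1} \<times> C\<close>.

  A permutation in the point stabilizer flips or fixes \<open>P\<close>, \<open>C/P\<close>, the pair \<open>\<plusminus>i\<close> and the pair
  \<open>{\<plusminus>j}, {\<plusminus>k}\<close>. The classes in \<open>\<langle>i\<rangle> \<times> P\<close> tie the flip of \<open>P\<close> to that of \<open>\<plusminus>i\<close>, those in
  \<open>\<langle>i\<rangle> \<times> (C - P)\<close> tie the flip of \<open>\<plusminus>i\<close> to that of \<open>C/P\<close>, and those outside both \<open>\<langle>i\<rangle>\<close> and \<open>P\<close>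
  tie the flip of \<open>C/P\<close> to that of \<open>{\<plusminus>j}, {\<plusminus>k}\<close>. However, \<open>(Q\<^sub>8 - \<langle>i\<rangle>) \<times> {y, -y}\<close> with \<open>y \<in> P\<close> is a
  single class, so if the S-ring were schurian, \<open>P\<close> could be flipped while \<open>{\<plusminus>j}\<close> is fixed.
\<close>

section \<open>S-rings as modules of class functions\<close>

text \<open>The classes are disjoint, so the coefficient of a class is the common value on that
  class. Membership in the span becomes an invariance condition, without coefficients.\<close>

lemma int_span_partition:
  assumes P: "partition_on A P" and fin: "finite A"
  shows "int_span (simple_quantity ` P) =
    {f. (\<forall>x. x \<notin> A \<longrightarrow> f x = 0) \<and> (\<forall>X\<in>P. \<forall>x\<in>X. \<forall>y\<in>X. f x = f y)}"
    (is "?L = ?R")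
proof -
  have finP: "finite P"
    using finite_elements[OF fin P] .
  have inj: "inj_on simple_quantity P"
    by (auto simp: inj_on_def simple_quantity_def fun_eq_iff)
  have val: "(\<Sum>f\<in>simple_quantity ` P. c f * f x) = c (simple_quantity X)"
    if "X \<in> P" "x \<in> X" for c X x
  proof -
    have "(\<Sum>f\<in>simple_quantity ` P. c f * f x) = (\<Sum>Y\<in>P. c (simple_quantity Y) * of_bool (x \<in> Y))"
      by (subst sum.reindex[OF inj]) (simp add: simple_quantity_def)
    also have "\<dots> = (\<Sum>Y\<in>P. if Y = X then c (simple_quantity X) else 0)"
      using that partition_onD2[OF P] by (intro sum.cong) (auto simp: disjoint_def)
    finally show ?thesis
      using that finP by simp
  qed
  have out: "(\<Sum>f\<in>simple_quantity ` P. c f * f x) = 0" if "x \<notin> A" for c x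
    using that partition_onD1[OF P] by (auto simp: simple_quantity_def intro!: sum.neutral)
  show ?thesis
  proof
    show "?L \<subseteq> ?R"
      unfolding int_span_def using val out by auto
    show "?R \<subseteq> ?L"
    proof
      fix f assume f: "f \<in> ?R"
      \<comment> \<open>The coefficient is read off at an arbitrary point of the class whose
        indicator is \<open>s\<close>.\<close>
      define c where "c s = f (SOME x. s x = 1)" for s :: "'a \<Rightarrow> int"
      have "f x = (\<Sum>s\<in>simple_quantity ` P. c s * s x)" for x
      proof (cases "x \<in> A")
        case True
        then obtain X where X: "X \<in> P" "x \<in> X"
          using partition_onD1[OF P] by auto
        have "(SOME x. simple_quantity X x = 1) \<in> X"
          using someI[of "\<lambda>x. simple_quantity X x = 1" x] X by (simp add: simple_quantity_def)
        then have "c (simple_quantity X) = f x"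
          using f X unfolding c_def by blast
        then show ?thesis
          using val X by simp
      qed (use f out in auto)
      then show "f \<in> ?L"
        unfolding int_span_def by auto
    qed
  qed
qed

lemma int_span_quotient:
  assumes "equiv A R" and "finite A"
  shows "int_span (simple_quantity ` (A // R)) =
    {f. (\<forall>x. x \<notin> A \<longrightarrow> f x = 0) \<and> (\<forall>x y. (x, y) \<in> R \<longrightarrow> f x = f y)}"
proof -
  have "(\<forall>X\<in>A // R. \<forall>x\<in>X. \<forall>y\<in>X. f x = f y) \<longleftrightarrow> (\<forall>x y. (x, y) \<in> R \<longrightarrow> f x = f y)"
    for f :: "'a \<Rightarrow> int"
  proof
    assume f: "\<forall>X\<in>A // R. \<forall>x\<in>X. \<forall>y\<in>X. f x = f y"
    show "\<forall>x y. (x, y) \<in> R \<longrightarrow> f x = f y"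
    proof (intro allI impI)
      fix x y assume xy: "(x, y) \<in> R"
      then have "x \<in> A"
        using assms(1) by (auto simp: equiv_def refl_on_def)
      then have "R `` {x} \<in> A // R" "x \<in> R `` {x}"
        using equiv_class_self[OF assms(1)] by (auto intro: quotientI)
      then show "f x = f y"
        using f xy by blast
    qed
  qed (use quotient_eq_iff[OF assms(1)] in blast)
  then show ?thesis
    by (simp add: int_span_partition[OF partition_on_quotient[OF assms(1)] assms(2)])
qed

section \<open>Convolution of class functions and a criterion for S-rings\<close>

text \<open>The substitution \<open>w = inv x \<otimes> z\<close> indexes the factorisations of
  \<open>z\<close> by their right factor, the form in which \<open>matching\<close> compares
  them.\<close>

lemma (in group) convolution_reindex:
  fixes f h :: "'a \<Rightarrow> int"
  assumes "z \<in> carrier G"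
  shows "(\<Sum>x\<in>carrier G. f x * h (inv x \<otimes> z)) = (\<Sum>w\<in>carrier G. f (z \<otimes> inv w) * h w)"
  by (rule sum.reindex_bij_witness[where i = "\<lambda>w. z \<otimes> inv w" and j = "\<lambda>x. inv x \<otimes> z"])
    (use assms in \<open>auto simp: inv_mult_group m_assoc[symmetric]\<close>, simp_all add: m_assoc)

text \<open>A matching \<open>\<tau>\<close> transports the factorisations of \<open>z\<close> to those of \<open>z'\<close>; unlike for a
  schurian S-ring, it may depend on the pair \<open>(z, z')\<close> and need not preserve \<open>R\<close>.\<close>

definition matching :: "('a, 'b) monoid_scheme \<Rightarrow> ('a \<times> 'a) set \<Rightarrow> 'a \<Rightarrow> 'a \<Rightarrow> ('a \<Rightarrow> 'a) \<Rightarrow> bool" where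
  "matching G R z z' \<tau> \<longleftrightarrow> inj_on \<tau> (carrier G) \<and>
    (\<forall>w\<in>carrier G. (w, \<tau> w) \<in> R \<and> (z \<otimes>\<^bsub>G\<^esub> inv\<^bsub>G\<^esub> w, z' \<otimes>\<^bsub>G\<^esub> inv\<^bsub>G\<^esub> (\<tau> w)) \<in> R)"

text \<open>Thanks to composition, matchings have to be found only for pairs that generate the
  relation.\<close>

lemma matching_trans:
  assumes "equiv (carrier G) R" "matching G R z z' \<tau>" "matching G R z' z'' \<rho>"
  shows "matching G R z z'' (\<rho> \<circ> \<tau>)"
proof -
  have "trans R" "R \<subseteq> carrier G \<times> carrier G"
    using assms(1) by (auto simp: equiv_def refl_on_def)
  moreover from this have sub: "\<tau> ` carrier G \<subseteq> carrier G"
    using assms(2) unfolding matching_def by auto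
  moreover have "inj_on (\<rho> \<circ> \<tau>) (carrier G)"
    using assms(2,3) sub unfolding matching_def by (auto intro: comp_inj_on inj_on_subset)
  ultimately show ?thesis
    using assms(2,3) unfolding matching_def by (simp add: image_subset_iff) (meson transD)
qed

text \<open>Closure under multiplication is the substantial point: for class functions, a matching
  identifies the coefficients of a product at \<open>z\<close> and \<open>z'\<close> term by
  term.\<close>

lemma (in group) is_S_ring_int_span:
  assumes fin: "finite (carrier G)" and R: "equiv (carrier G) R"
    and one: "R `` {\<one>} = {\<one>}"
    and inv: "\<And>x y. (x, y) \<in> R \<Longrightarrow> (inv x, inv y) \<in> R"
    and matching: "\<And>z z'. (z, z') \<in> R \<Longrightarrow> \<exists>\<tau>. matching G R z z' \<tau>"
  shows "is_S_ring G (int_span (simple_quantity ` (carrier G // R)))"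
    (is "is_S_ring G ?A")
proof -
  interpret RR: ring "int_group_ring G"
    by (rule ring_int_group_ring[OF is_group fin])
  note A = int_span_quotient[OF R fin]
  have Rc: "R \<subseteq> carrier G \<times> carrier G"
    using R by (auto simp: equiv_def refl_on_def)
  have minus: "\<ominus>\<^bsub>int_group_ring G\<^esub> f = (\<lambda>x. - f x)" if "f \<in> carrier (int_group_ring G)" for f
    using that by (intro RR.minus_equality) (auto simp: int_group_ring_def)
  have "subring ?A (int_group_ring G)"
  proof (rule RR.subringI)
    show "?A \<subseteq> carrier (int_group_ring G)"
      by (auto simp: A int_group_ring_def)
    have "x = \<one> \<longleftrightarrow> y = \<one>" if "(x, y) \<in> R" for x y
      using that one R by (auto simp: equiv_def sym_def)
    then show "\<one>\<^bsub>int_group_ring G\<^esub> \<in> ?A"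
      by (auto simp: A int_group_ring_def)
  next
    fix f assume "f \<in> ?A"
    then show "\<ominus>\<^bsub>int_group_ring G\<^esub> f \<in> ?A"
      by (subst minus) (auto simp: A int_group_ring_def)
  next
    fix f h assume fh: "f \<in> ?A" "h \<in> ?A"
    then show "f \<oplus>\<^bsub>int_group_ring G\<^esub> h \<in> ?A"
      by (auto simp: A int_group_ring_def)
    have "(\<Sum>x\<in>carrier G. f x * h (inv x \<otimes> z)) = (\<Sum>x\<in>carrier G. f x * h (inv x \<otimes> z'))"
      if zz': "(z, z') \<in> R" for z z'
    proof -
      obtain \<tau> where \<tau>: "matching G R z z' \<tau>"
        using matching[OF zz'] by blast
      have "\<tau> ` carrier G \<subseteq> carrier G"
        using \<tau> Rc unfolding matching_def by auto
      \<comment> \<open>An injection of the finite carrier into itself is onto, so it can reindex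
        the sum.\<close>
      then have bij: "bij_betw \<tau> (carrier G) (carrier G)"
        using \<tau> fin unfolding matching_def bij_betw_def by (metis endo_inj_surj)
      have "(\<Sum>w\<in>carrier G. f (z \<otimes> inv w) * h w)
          = (\<Sum>w\<in>carrier G. f (z' \<otimes> inv (\<tau> w)) * h (\<tau> w))"
      proof (rule sum.cong[OF refl])
        fix w assume "w \<in> carrier G"
        then have "f (z \<otimes> inv w) = f (z' \<otimes> inv (\<tau> w))" "h w = h (\<tau> w)"
          using \<tau> fh unfolding matching_def A by blast+
        then show "f (z \<otimes> inv w) * h w = f (z' \<otimes> inv (\<tau> w)) * h (\<tau> w)"
          by simp
      qed
      also have "\<dots> = (\<Sum>w\<in>carrier G. f (z' \<otimes> inv w) * h w)"
        by (rule sum.reindex_bij_betw[OF bij])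
      finally show ?thesis
        using zz' Rc by (auto simp: convolution_reindex)
    qed
    then show "f \<otimes>\<^bsub>int_group_ring G\<^esub> h \<in> ?A"
      using Rc unfolding A by (auto simp: int_group_ring_def)
  qed
  moreover have "partition_on (carrier G) (carrier G // R)"
    by (rule partition_on_quotient[OF R])
  moreover have "{\<one>} \<in> carrier G // R"
    using one quotientI[OF one_closed, of R] by simp
  moreover have "m_inv G ` X \<in> carrier G // R" if X: "X \<in> carrier G // R" for X
  proof -
    obtain x where x: "x \<in> carrier G" "X = R `` {x}"
      using X by (rule quotientE)
    have "m_inv G ` (R `` {x}) = R `` {inv x}"
    proof (intro equalityI subsetI)
      fix y assume y: "y \<in> R `` {inv x}"
      then have "(x, inv y) \<in> R"
        using inv[of "inv x" y] x by simp
      moreover have "y = inv (inv y)"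
        using y Rc by auto
      ultimately show "y \<in> m_inv G ` (R `` {x})"
        by blast
    qed (auto intro: inv)
    then show ?thesis
      using x by (simp add: quotientI)
  qed
  ultimately show ?thesis
    unfolding is_S_ring_def by blast
qed

section \<open>Permutation groups realising a schurian S-ring\<close>

lemma subgroup_BijGroup_action:
  assumes "subgroup K (BijGroup E)"
  shows "group_action (BijGroup E\<lparr>carrier := K\<rparr>) E (\<lambda>f. f)"
proof (rule group_action.intro)
  interpret B: group "BijGroup E" by (rule group_BijGroup)
  interpret K: group "BijGroup E\<lparr>carrier := K\<rparr>"
    by (rule subgroup.subgroup_is_group[OF assms B.is_group])
  show "group_hom (BijGroup E\<lparr>carrier := K\<rparr>) (BijGroup E) (\<lambda>f. f)"
    using subgroup.subset[OF assms] by unfold_locales (auto simp: hom_def)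
qed

text \<open>Equal modules have equal underlying partitions, so the orbits of the stabilizer are the
  classes. Right translations reduce a pair \<open>(a, b)\<close> to
  \<open>(\<one>, b \<otimes> inv a)\<close>, which turns this into a statement about all of
  \<open>K\<close>.\<close>

lemma (in group) schurian_int_spanE:
  assumes fin: "finite (carrier G)" and R: "equiv (carrier G) R"
    and schurian: "schurian G (int_span (simple_quantity ` (carrier G // R)))"
  obtains K where "K \<subseteq> Bij (carrier G)"
    and "\<And>g a b. g \<in> K \<Longrightarrow> a \<in> carrier G \<Longrightarrow> b \<in> carrier G \<Longrightarrow>
      (b \<otimes> inv a, g b \<otimes> inv (g a)) \<in> R"
    and "\<And>x y. (x, y) \<in> R \<Longrightarrow> \<exists>g\<in>K. g \<one> = \<one> \<and> g x = y"
proof -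
  let ?A = "int_span (simple_quantity ` (carrier G // R))"
  let ?B = "BijGroup (carrier G)"
  interpret B: group ?B by (rule group_BijGroup)
  obtain K where K: "subgroup K ?B" "right_translations G \<subseteq> K" "?A = transitivity_module G K"
    using schurian unfolding schurian_def by blast
  interpret actK: group_action "?B\<lparr>carrier := K\<rparr>" "carrier G" "\<lambda>f. f"
    by (rule subgroup_BijGroup_action[OF K(1)])
  let ?S = "point_stabilizer G K"
  have S_eq: "?S = {g \<in> K. g \<one> = \<one>}"
    by (simp add: point_stabilizer_def stabilizer_def)
  have "subgroup ?S (?B\<lparr>carrier := K\<rparr>)"
    unfolding point_stabilizer_def by (rule actK.stabilizer_subgroup) simp
  then have S: "subgroup ?S ?B"
    using B.incl_subgroup[OF K(1)] by simp
  interpret actS: group_action "?B\<lparr>carrier := ?S\<rparr>" "carrier G" "\<lambda>f. f"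
    by (rule subgroup_BijGroup_action[OF S])
  let ?O = "orbits (?B\<lparr>carrier := ?S\<rparr>) (carrier G) (\<lambda>f. f)"
  let ?orb = "orbit (?B\<lparr>carrier := ?S\<rparr>) (\<lambda>f. f)"
  have orb_eq: "?orb x = {g x | g. g \<in> ?S}" for x
    by (simp add: orbit_def)
  have part: "partition_on (carrier G) ?O"
  proof (rule partition_onI)
    show "{} \<notin> ?O"
      unfolding orbits_def using actS.orbit_refl by auto
  qed (use actS.orbits_coverture actS.disjoint_union in \<open>auto simp: disjnt_def\<close>)
  have A: "?A = {f. (\<forall>x. x \<notin> carrier G \<longrightarrow> f x = 0) \<and> (\<forall>X\<in>?O. \<forall>x\<in>X. \<forall>y\<in>X. f x = f y)}"
    unfolding K(3) transitivity_module_def by (rule int_span_partition[OF part fin])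
  note A' = int_span_quotient[OF R fin]
  have Rc: "R \<subseteq> carrier G \<times> carrier G"
    using R by (auto simp: equiv_def refl_on_def)
  have orb_closed: "g x \<in> carrier G" if "g \<in> K" "x \<in> carrier G" for g x
    using actK.element_image that by simp
  have orb_R: "(x, g x) \<in> R" if g: "g \<in> ?S" and x: "x \<in> carrier G" for g x
  proof -
    \<comment> \<open>The indicator of a class is constant on orbits, so each orbit lies inside a
      class; \<open>R_orb\<close> below is the converse, with the indicator of an orbit.\<close>
    have "simple_quantity (R `` {x}) \<in> ?A"
      using Rc R unfolding A' simple_quantity_def equiv_def
      by (auto dest: transD symD)
    moreover have "?orb x \<in> ?O" "x \<in> ?orb x" "g x \<in> ?orb x"
      using x g actS.orbit_refl[OF x] by (auto simp: orbits_def orb_eq)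
    ultimately have "simple_quantity (R `` {x}) x = simple_quantity (R `` {x}) (g x)"
      unfolding A by blast
    then show ?thesis
      using x R by (auto simp: simple_quantity_def equiv_def refl_on_def split: if_splits)
  qed
  have R_orb: "\<exists>g\<in>?S. g x = y" if xy: "(x, y) \<in> R" for x y
  proof -
    have x: "x \<in> carrier G"
      using xy Rc by auto
    have "?orb x \<subseteq> carrier G"
      using x orb_closed by (auto simp: orbit_def S_eq)
    moreover have "?orb x \<in> ?O"
      using x by (auto simp: orbits_def)
    ultimately have "simple_quantity (?orb x) \<in> ?A"
      using actS.disjoint_union unfolding A simple_quantity_def
      by (force simp: of_bool_def)
    then have "simple_quantity (?orb x) x = simple_quantity (?orb x) y"
      using xy unfolding A' by blast
    then have "y \<in> ?orb x"
      using actS.orbit_refl[OF x] by (auto simp: simple_quantity_def split: if_splits)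
    then show ?thesis
      by (auto simp: orb_eq)
  qed
  show thesis
  proof
    show "K \<subseteq> Bij (carrier G)"
      using subgroup.subset[OF K(1)] by (simp add: BijGroup_def)
    show "\<exists>g\<in>K. g \<one> = \<one> \<and> g x = y" if "(x, y) \<in> R" for x y
      using R_orb[OF that] by (auto simp: S_eq)
    fix g a b assume g: "g \<in> K" and a: "a \<in> carrier G" and b: "b \<in> carrier G"
    define r where "r c = (\<lambda>x\<in>carrier G. x \<otimes> c)" for c
    have r: "r c \<in> K" if "c \<in> carrier G" for c
      using that K(2) by (auto simp: r_def right_translations_def)
    have ga: "g a \<in> carrier G"
      using g a by (rule orb_closed)
    \<comment> \<open>Translations before and after \<open>g\<close> produce an element of
      \<open>K\<close> that fixes \<open>\<one>\<close>.\<close>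
    define h where "h = r (inv (g a)) \<otimes>\<^bsub>?B\<^esub> (g \<otimes>\<^bsub>?B\<^esub> r a)"
    have gr: "g \<otimes>\<^bsub>?B\<^esub> r a \<in> K"
      using g r[OF a] subgroup.m_closed[OF K(1)] by blast
    then have hK: "h \<in> K"
      using r ga subgroup.m_closed[OF K(1)] unfolding h_def by blast
    have h: "h x = g (x \<otimes> a) \<otimes> inv (g a)" if x: "x \<in> carrier G" for x
    proof -
      have "h x = r (inv (g a)) ((g \<otimes>\<^bsub>?B\<^esub> r a) x)"
        unfolding h_def using actK.composition_rule[OF x, of "r (inv (g a))" "g \<otimes>\<^bsub>?B\<^esub> r a"] gr r ga
        by simp
      also have "(g \<otimes>\<^bsub>?B\<^esub> r a) x = g (r a x)"
        using actK.composition_rule[OF x, of g "r a"] g r[OF a] by simp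
      finally show ?thesis
        using x a orb_closed[OF g, of "x \<otimes> a"] by (simp add: r_def)
    qed
    have "h \<in> ?S"
      using hK h[OF one_closed] a ga by (simp add: S_eq)
    then have "(b \<otimes> inv a, h (b \<otimes> inv a)) \<in> R"
      using a b by (intro orb_R) auto
    then show "(b \<otimes> inv a, g b \<otimes> inv (g a)) \<in> R"
      using a b by (simp add: h m_assoc)
  qed
qed

section \<open>Quaternions\<close>

text \<open>On \<open>Q8\<close> this is membership in \<open>\<langle>i\<rangle>\<close>.\<close>

fun in_cyc :: "quaternion \<Rightarrow> bool" where
  "in_cyc (a, b, c, d) \<longleftrightarrow> c = 0 \<and> d = 0"

fun qneg :: "quaternion \<Rightarrow> quaternion" where
  "qneg (a, b, c, d) = (-a, -b, -c, -d)"

fun qconj :: "quaternion \<Rightarrow> quaternion" where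
  "qconj (a, b, c, d) = (a, -b, -c, -d)"

text \<open>This is \<open>\<sigma>\<close> on the quaternion factor; the sign at \<open>i\<close>
  makes up for the reversed product when \<open>j\<close> and \<open>k\<close> are
  exchanged.\<close>

fun qflip :: "quaternion \<Rightarrow> quaternion" where
  "qflip (a, b, c, d) = (a, -b, d, c)"

abbreviation qdiff :: "quaternion \<Rightarrow> quaternion \<Rightarrow> quaternion" where
  "qdiff u v \<equiv> hamilton_mult u (qconj v)"

lemma qneg_qneg [simp]: "qneg (qneg u) = u"
  by (cases u) simp

lemma qflip_qflip [simp]: "qflip (qflip u) = u"
  by (cases u) simp

lemma in_cyc_qneg [simp]: "in_cyc (qneg u) \<longleftrightarrow> in_cyc u"
  by (cases u) simp

lemma in_cyc_qflip [simp]: "in_cyc (qflip u) \<longleftrightarrow> in_cyc u"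
  by (cases u) auto

lemma qflip_qneg: "qflip (qneg u) = qneg (qflip u)"
  by (cases u) simp

lemma in_cyc_qconj [simp]: "in_cyc (qconj u) \<longleftrightarrow> in_cyc u"
  by (cases u) simp

lemma qconj_qneg: "qconj (qneg u) = qneg (qconj u)"
  by (cases u) simp

lemma qconj_qflip: "qconj (qflip u) = qflip (qconj u)"
  by (cases u) simp

lemma qdiff_qflip: "qdiff (qflip u) (qflip v) = qflip (qdiff u v)"
  by (cases u; cases v) (simp add: algebra_simps)

lemma qdiff_qneg_left: "qdiff (qneg u) v = qneg (qdiff u v)"
  by (cases u; cases v) (simp add: algebra_simps)

lemma qdiff_qneg_right: "qdiff u (qneg v) = qneg (qdiff u v)"
  by (cases u; cases v) (simp add: algebra_simps)

lemma mult_Q8: "u \<otimes>\<^bsub>Q8\<^esub> v = hamilton_mult u v"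
  by (simp add: Q8_def)

lemma one_Q8: "\<one>\<^bsub>Q8\<^esub> = (1, 0, 0, 0)"
  by (simp add: Q8_def)

lemma qconj_Q8: "u \<in> carrier Q8 \<Longrightarrow> qconj u \<in> carrier Q8"
  by (auto simp: Q8_def)

lemma qneg_Q8: "u \<in> carrier Q8 \<Longrightarrow> qneg u \<in> carrier Q8"
  by (auto simp: Q8_def)

lemma qflip_Q8: "u \<in> carrier Q8 \<Longrightarrow> qflip u \<in> carrier Q8"
  by (auto simp: Q8_def)

lemma inv_Q8:
  assumes "u \<in> carrier Q8"
  shows "inv\<^bsub>Q8\<^esub> u = qconj u"
proof (rule group.inv_equality[OF group_Q8])
  show "qconj u \<otimes>\<^bsub>Q8\<^esub> u = \<one>\<^bsub>Q8\<^esub>"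
    using assms by (auto simp: Q8_def)
qed (use assms qconj_Q8 in auto)

lemma hamilton_mult_Q8:
  "u \<in> carrier Q8 \<Longrightarrow> v \<in> carrier Q8 \<Longrightarrow> hamilton_mult u v \<in> carrier Q8"
  using group.is_monoid[OF group_Q8] monoid.m_closed[of Q8 u v] by (simp add: mult_Q8)

lemma in_cyc_qdiff:
  "u \<in> carrier Q8 \<Longrightarrow> v \<in> carrier Q8 \<Longrightarrow> in_cyc (qdiff u v) \<longleftrightarrow> (in_cyc u \<longleftrightarrow> in_cyc v)"
  unfolding Q8_def by auto

lemma in_cyc_qdiff_qflip:
  "u \<in> carrier Q8 \<Longrightarrow> in_cyc (qdiff (qflip u) u)"
  unfolding Q8_def by auto

text \<open>With \<open>e = qdiff (qflip u) u\<close>, the left side is the conjugate of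
  \<open>qdiff u v\<close> by \<open>e\<close>. Both lie in the abelian group
  \<open>\<langle>i\<rangle>\<close>, so the conjugation is trivial.\<close>

lemma qdiff_qflip_rotate:
  "u \<in> carrier Q8 \<Longrightarrow> v \<in> carrier Q8 \<Longrightarrow> \<not> in_cyc u \<Longrightarrow> \<not> in_cyc v \<Longrightarrow>
    qdiff (qflip u) (hamilton_mult (qdiff (qflip u) u) v) = qdiff u v"
  unfolding Q8_def by auto

lemma in_cyc_hamilton_mult:
  "in_cyc u \<Longrightarrow> u \<in> carrier Q8 \<Longrightarrow> v \<in> carrier Q8 \<Longrightarrow> in_cyc (hamilton_mult u v) \<longleftrightarrow> in_cyc v"
  unfolding Q8_def by auto

lemma not_in_cyc_cases:
  "u \<in> carrier Q8 \<Longrightarrow> v \<in> carrier Q8 \<Longrightarrow> \<not> in_cyc u \<Longrightarrow> \<not> in_cyc v \<Longrightarrow>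
    v = u \<or> v = qneg u \<or> v = qflip u \<or> v = qneg (qflip u)"
  unfolding Q8_def by auto

section \<open>The partition\<close>

text \<open>
  Here \<open>q\<close> and \<open>n\<close> are the orders of \<open>C/P\<close> and \<open>C\<close>. Elements of \<open>C\<close> are represented by
  arbitrary integers, so \<open>q dvd c\<close> means \<open>c \<in> P\<close>; \<open>near\<close> says that \<open>w\<close> and \<open>w'\<close> lie in the same
  coset of the subgroup \<open>H\<close> belonging to \<open>w\<close>.
\<close>

fun near :: "int \<Rightarrow> int \<Rightarrow> quaternion \<times> int \<Rightarrow> quaternion \<times> int \<Rightarrow> bool" where
  "near q n (u, c) (u', c') \<longleftrightarrow>
    (in_cyc u \<longleftrightarrow> in_cyc u') \<and> q dvd c - c' \<and>
    (in_cyc u \<longrightarrow> u' = u) \<and>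
    (\<not> in_cyc u \<and> \<not> q dvd c \<longrightarrow> u' = u \<or> u' = qneg u) \<and>
    (q dvd c \<longrightarrow> n dvd c - c')"

fun flip :: "quaternion \<times> int \<Rightarrow> quaternion \<times> int" where
  "flip (u, c) = (qflip u, - c)"

fun diff :: "quaternion \<times> int \<Rightarrow> quaternion \<times> int \<Rightarrow> quaternion \<times> int" where
  "diff (u, c) (v, d) = (qdiff u v, c - d)"

definition sim :: "int \<Rightarrow> int \<Rightarrow> quaternion \<times> int \<Rightarrow> quaternion \<times> int \<Rightarrow> bool" where
  "sim q n w w' \<longleftrightarrow> near q n w w' \<or> near q n (flip w) w'"

lemma dvd_iff_of_dvd_diff: "(q::int) dvd c - c' \<Longrightarrow> q dvd c \<longleftrightarrow> q dvd c'"
  using dvd_add_right_iff[of q "c - c'" c'] by simp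

lemma flip_flip [simp]: "flip (flip w) = w"
  by (cases w) simp

lemma near_refl [simp]: "near q n w w"
  by (cases w) simp

text \<open>The conditions \<open>in_cyc u\<close> and \<open>q dvd c\<close> agree at both points,
  so the same subgroup \<open>H\<close> governs both.\<close>

lemma near_sym:
  assumes "near q n w w'"
  shows "near q n w' w"
proof -
  obtain u c u' c' where w: "w = (u, c)" "w' = (u', c')"
    by (cases w; cases w')
  show ?thesis
    using assms dvd_iff_of_dvd_diff[of q c c'] unfolding w near.simps
    by (metis dvd_diff_commute qneg_qneg)
qed

lemma near_trans:
  assumes "near q n w w'" "near q n w' w''"
  shows "near q n w w''"
proof -
  obtain u c u' c' u'' c'' where w: "w = (u, c)" "w' = (u', c')" "w'' = (u'', c'')"
    by (cases w; cases w'; cases w'')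
  have "m dvd c - c''" if "m dvd c - c'" "m dvd c' - c''" for m
    using dvd_add[OF that] by simp
  then show ?thesis
    using assms dvd_iff_of_dvd_diff[of q c c'] unfolding w near.simps by (metis qneg_qneg)
qed

text \<open>Each \<open>H\<close> is invariant under \<open>\<sigma>\<close> and is the same for a
  point and its image. This makes \<open>sim\<close> symmetric and transitive.\<close>

lemma near_flip:
  assumes "near q n w w'"
  shows "near q n (flip w) (flip w')"
proof -
  obtain u c u' c' where w: "w = (u, c)" "w' = (u', c')"
    by (cases w; cases w')
  have "m dvd - c - - c' \<longleftrightarrow> m dvd c - c'" for m
    using dvd_diff_commute[of m c c'] by simp
  then show ?thesis
    using assms unfolding w flip.simps near.simps
    by (metis dvd_minus_iff in_cyc_qflip qflip_qneg)
qed

lemma sim_qconj: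
  assumes "sim q n (u, c) (u', c')"
  shows "sim q n (qconj u, - c) (qconj u', - c')"
proof -
  have near: "near q n (qconj u, - c) (qconj u', - c')" if "near q n (u, c) (u', c')" for u c
  proof -
    have "m dvd - c - - c' \<longleftrightarrow> m dvd c - c'" for m
      using dvd_diff_commute[of m c c'] by simp
    then show ?thesis
      using that unfolding near.simps by (metis dvd_minus_iff in_cyc_qconj qconj_qneg)
  qed
  show ?thesis
    using assms near[of u c] near[of "qflip u" "- c"] unfolding sim_def flip.simps qconj_qflip by blast
qed

lemma near_imp_sim: "near q n w w' \<Longrightarrow> sim q n w w'"
  by (simp add: sim_def)

lemma sim_refl [simp]: "sim q n w w"
  by (simp add: sim_def)

lemma sim_flip [simp]: "sim q n w (flip w)"
  by (simp add: sim_def)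

lemma sim_sym: "sim q n w w' \<Longrightarrow> sim q n w' w"
  unfolding sim_def using near_sym near_flip by (metis flip_flip)

lemma sim_trans: "sim q n w w' \<Longrightarrow> sim q n w' w'' \<Longrightarrow> sim q n w w''"
  unfolding sim_def by (metis near_trans near_flip flip_flip)

lemma near_mod: "near q n (u, c) (u, c mod n)" if "q dvd n"
proof -
  have "n dvd c - c mod n"
    by simp
  moreover from this have "q dvd c - c mod n"
    using that dvd_trans by blast
  ultimately show ?thesis
    by simp
qed

text \<open>Second components may be handled as plain integers, with reduction modulo
  \<open>n\<close> ignored.\<close>

lemma sim_mod_iff:
  assumes "q dvd n"
  shows "sim q n (u, c mod n) w \<longleftrightarrow> sim q n (u, c) w" "sim q n w (u, c mod n) \<longleftrightarrow> sim q n w (u, c)"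
proof -
  have "sim q n (u, c) (u, c mod n)" "sim q n (u, c mod n) (u, c)"
    using near_imp_sim[OF near_mod[OF assms]] sim_sym by blast+
  then show "sim q n (u, c mod n) w \<longleftrightarrow> sim q n (u, c) w"
    "sim q n w (u, c mod n) \<longleftrightarrow> sim q n w (u, c)"
    by (meson sim_trans)+
qed

definition rel :: "nat \<Rightarrow> nat \<Rightarrow> ((quaternion \<times> int) \<times> (quaternion \<times> int)) set" where
  "rel q n = {(w, w'). w \<in> carrier (Q8 \<times>\<times> integer_mod_group n) \<and>
    w' \<in> carrier (Q8 \<times>\<times> integer_mod_group n) \<and> sim (int q) (int n) w w'}"

locale Q8_mod =
  fixes q n :: nat
  assumes n_pos: "0 < n" and q_dvd_n: "q dvd n"
begin

abbreviation G :: "(quaternion \<times> int) monoid" where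
  "G \<equiv> Q8 \<times>\<times> integer_mod_group n"

abbreviation near' (infix \<open>\<approx>\<close> 50) where
  "w \<approx> w' \<equiv> near (int q) (int n) w w'"

abbreviation sim' (infix \<open>\<sim>\<close> 50) where
  "w \<sim> w' \<equiv> sim (int q) (int n) w w'"

lemma group_G: "group G"
  by (intro DirProd_group group_Q8 group_integer_mod_group)

lemma int_q_dvd: "int q dvd int n"
  using q_dvd_n by simp

lemma carrier_mod [simp]: "carrier (integer_mod_group n) = {0..<int n}"
  using n_pos by (simp add: carrier_integer_mod_group)

lemma carrier_G: "(u, c) \<in> carrier G \<longleftrightarrow> u \<in> carrier Q8 \<and> 0 \<le> c \<and> c < int n"
  using n_pos by (auto simp: DirProd_def carrier_integer_mod_group)

lemma finite_G: "finite (carrier G)"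
  using n_pos by (auto simp: DirProd_def carrier_integer_mod_group Q8_def)

lemma inv_G: "(u, c) \<in> carrier G \<Longrightarrow> inv\<^bsub>G\<^esub> (u, c) = (qconj u, (- c) mod int n)"
  using n_pos by (subst inv_DirProd)
    (auto simp: carrier_G group_Q8 inv_Q8 carrier_integer_mod_group)

lemma mult_inv_G:
  assumes "z \<in> carrier G" "w \<in> carrier G"
  shows "z \<otimes>\<^bsub>G\<^esub> inv\<^bsub>G\<^esub> w = (fst (diff z w), snd (diff z w) mod int n)"
  using assms by (cases z; cases w) (simp add: inv_G mult_Q8 mod_add_right_eq)

lemma mod_closed: "u \<in> carrier Q8 \<Longrightarrow> (u, c mod int n) \<in> carrier G"
  using n_pos by (simp add: carrier_G)

lemma eq_of_dvd_diff:
  "(u, c) \<in> carrier G \<Longrightarrow> (v, d) \<in> carrier G \<Longrightarrow> int n dvd c - d \<Longrightarrow> c = d"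
  unfolding carrier_G mod_eq_dvd_iff[symmetric] by simp

lemma equiv_rel: "equiv (carrier G) (rel q n)"
  by (intro equivI refl_onI symI transI)
    (auto simp: rel_def intro: sim_sym sim_trans)

lemma diff_rel_iff:
  assumes "z \<in> carrier G" "w \<in> carrier G" "z' \<in> carrier G" "w' \<in> carrier G"
  shows "(z \<otimes>\<^bsub>G\<^esub> inv\<^bsub>G\<^esub> w, z' \<otimes>\<^bsub>G\<^esub> inv\<^bsub>G\<^esub> w') \<in> rel q n \<longleftrightarrow> diff z w \<sim> diff z' w'"
proof -
  have "z \<otimes>\<^bsub>G\<^esub> inv\<^bsub>G\<^esub> w \<in> carrier G" "z' \<otimes>\<^bsub>G\<^esub> inv\<^bsub>G\<^esub> w' \<in> carrier G"
    using assms group_G by (meson group.inv_closed group.is_monoid monoid.m_closed)+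
  then show ?thesis
    unfolding rel_def using assms by (simp add: mult_inv_G sim_mod_iff[OF int_q_dvd])
qed

section \<open>Matchings for the moves that generate the relation\<close>

lemma exists_matching:
  assumes z: "z \<in> carrier G" "z' \<in> carrier G"
    and T: "\<And>w. w \<in> carrier G \<Longrightarrow> fst (T w) \<in> carrier Q8"
      "\<And>w. w \<in> carrier G \<Longrightarrow> w \<sim> T w"
      "\<And>w. w \<in> carrier G \<Longrightarrow> diff z w \<sim> diff z' (T w)"
    and inj: "\<And>w w'. w \<in> carrier G \<Longrightarrow> w' \<in> carrier G \<Longrightarrow> fst (T w) = fst (T w') \<Longrightarrow>
      int n dvd snd (T w) - snd (T w') \<Longrightarrow> w = w'"
  shows "\<exists>\<tau>. matching G (rel q n) z z' \<tau>"
proof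
  let ?\<tau> = "\<lambda>w. (fst (T w), snd (T w) mod int n)"
  have closed: "?\<tau> w \<in> carrier G" if "w \<in> carrier G" for w
    using T(1)[OF that] by (rule mod_closed)
  have "diff z' (?\<tau> w) \<approx> diff z' (T w)" for w
  proof -
    have "int n dvd snd (T w) - snd (T w) mod int n"
      by simp
    then have "int n dvd (snd z' - snd (T w) mod int n) - (snd z' - snd (T w))"
      by (simp add: algebra_simps)
    moreover from this have "int q dvd (snd z' - snd (T w) mod int n) - (snd z' - snd (T w))"
      using int_q_dvd dvd_trans by blast
    ultimately show ?thesis
      by (cases z'; cases "T w") simp
  qed
  then have "diff z w \<sim> diff z' (?\<tau> w)" if "w \<in> carrier G" for w
    using T(3)[OF that] near_sym near_imp_sim sim_trans by meson
  moreover have "w \<sim> ?\<tau> w" if "w \<in> carrier G" for w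
    using T(2)[OF that] by (simp add: sim_mod_iff[OF int_q_dvd])
  moreover have "inj_on ?\<tau> (carrier G)"
    using inj by (intro inj_onI) (auto simp: mod_eq_dvd_iff simp del: carrier_DirProd)
  ultimately show "matching G (rel q n) z z' ?\<tau>"
    unfolding matching_def using z closed diff_rel_iff by (simp add: rel_def)
qed

text \<open>As \<open>\<sigma>\<close> is an automorphism that preserves every class, it is itself a
  matching.\<close>

lemma matching_flip:
  assumes z: "(u, c) \<in> carrier G"
  shows "\<exists>\<tau>. matching G (rel q n) (u, c) (qflip u, (- c) mod int n) \<tau>"
proof (rule exists_matching[where T = flip])
  fix w assume w: "w \<in> carrier G"
  obtain v d where wv: "w = (v, d)"
    by (cases w)
  show "fst (flip w) \<in> carrier Q8"
    using w by (simp add: wv carrier_G qflip_Q8)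
  show "w \<sim> flip w"
    by simp
  have "diff (qflip u, (- c) mod int n) (flip w) = (qflip (qdiff u v), (- c) mod int n + d)"
    by (simp add: wv qdiff_qflip)
  moreover have "(qflip (qdiff u v), ((- c) mod int n + d) mod int n) \<sim> diff (u, c) w"
    using sim_sym[OF sim_flip[of "int q" "int n" "diff (u, c) w"]]
    by (simp add: mod_add_left_eq sim_mod_iff[OF int_q_dvd] wv)
  ultimately show "diff (u, c) w \<sim> diff (qflip u, (- c) mod int n) (flip w)"
    by (simp add: sim_mod_iff[OF int_q_dvd] sim_sym)
next
  fix w w' assume w: "w \<in> carrier G" "w' \<in> carrier G"
    and eq: "fst (flip w) = fst (flip w')" "int n dvd snd (flip w) - snd (flip w')"
  obtain v d v' d' where wv: "w = (v, d)" "w' = (v', d')"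
    by (cases w; cases w')
  have "v = v'"
    using eq(1) qflip_qflip by (metis wv flip.simps fst_conv)
  moreover have "d' = d"
    using eq(2) w by (intro eq_of_dvd_diff[of v' d' v d]) (simp_all add: wv)
  ultimately show "w = w'"
    by (simp add: wv)
qed (use z in \<open>auto simp: carrier_G qflip_Q8 n_pos\<close>)

text \<open>Only the coset of \<open>P\<close> containing \<open>c\<close> is shifted. It avoids
  \<open>P\<close>, so its points stay in their classes and their differences are unchanged; for all
  other points the difference lies outside \<open>P\<close>, where classes absorb shifts by
  \<open>P\<close>.\<close>

lemma matching_shift:
  assumes z: "(u, c) \<in> carrier G" "(u, c') \<in> carrier G"
    and c: "\<not> int q dvd c" "int q dvd c - c'"
  shows "\<exists>\<tau>. matching G (rel q n) (u, c) (u, c') \<tau>"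
proof -
  define T where "T w = (fst w, if int q dvd c - snd w then snd w + (c' - c) else snd w)"
    for w :: "quaternion \<times> int"
  have c': "int q dvd c' - c"
    using c(2) by (simp add: dvd_diff_commute)
  show ?thesis
  proof (rule exists_matching[OF z, where T = T])
    fix w assume w: "w \<in> carrier G"
    obtain v d where wv: "w = (v, d)"
      by (cases w)
    show "fst (T w) \<in> carrier Q8"
      using w by (simp add: wv carrier_G T_def)
    have "\<not> int q dvd d" if "int q dvd c - d"
      using that c(1) dvd_iff_of_dvd_diff by blast
    then show "w \<sim> T w"
      using c(2) by (intro near_imp_sim) (simp add: T_def wv)
    show "diff (u, c) w \<sim> diff (u, c') (T w)"
      using c(2) by (intro near_imp_sim) (simp add: T_def wv)
  next
    fix w w' assume w: "w \<in> carrier G" "w' \<in> carrier G"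
      and eq: "fst (T w) = fst (T w')" "int n dvd snd (T w) - snd (T w')"
    obtain v d v' d' where wv: "w = (v, d)" "w' = (v', d')"
      by (cases w; cases w')
    have "int q dvd snd (T w) - snd (T w')"
      using eq(2) int_q_dvd dvd_trans by blast
    moreover have "int q dvd snd (T w) - d" "int q dvd snd (T w') - d'"
      using c' by (auto simp: T_def wv)
    ultimately have "int q dvd (snd (T w) - snd (T w')) - (snd (T w) - d) + (snd (T w') - d')"
      by (blast intro: dvd_add dvd_diff)
    then have "int q dvd (c - d') - (c - d)"
      by simp
    then have "int q dvd c - d \<longleftrightarrow> int q dvd c - d'"
      using dvd_iff_of_dvd_diff by blast
    then have "int n dvd d - d'"
      using eq(2) by (simp add: T_def wv split: if_splits)
    then have "d = d'"
      using w by (intro eq_of_dvd_diff[of v d v' d']) (simp_all add: wv)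
    then show "w = w'"
      using eq(1) by (simp add: wv T_def)
  qed
qed

text \<open>Negating the points outside \<open>\<langle>i\<rangle>\<close> preserves the quotient
  there; for points in \<open>\<langle>i\<rangle>\<close> the quotient lies outside
  \<open>\<langle>i\<rangle>\<close>, where classes absorb the sign.\<close>

lemma matching_qneg:
  assumes z: "(u, c) \<in> carrier G" and u: "\<not> in_cyc u"
  shows "\<exists>\<tau>. matching G (rel q n) (u, c) (qneg u, c) \<tau>"
proof -
  define T where "T w = (if in_cyc (fst w) then fst w else qneg (fst w), snd w)"
    for w :: "quaternion \<times> int"
  show ?thesis
  proof (rule exists_matching[OF z, where T = T])
    fix w assume w: "w \<in> carrier G"
    obtain v d where wv: "w = (v, d)"
      by (cases w)
    show "fst (T w) \<in> carrier Q8"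
      using w by (simp add: wv carrier_G T_def qneg_Q8)
    show "w \<sim> T w"
      by (intro near_imp_sim) (simp add: T_def wv)
    show "diff (u, c) w \<sim> diff (qneg u, c) (T w)"
      using w z u in_cyc_qdiff[of u v]
      by (intro near_imp_sim)
        (simp add: T_def wv carrier_G qdiff_qneg_left qdiff_qneg_right)
  next
    fix w w' assume w: "w \<in> carrier G" "w' \<in> carrier G"
      and eq: "fst (T w) = fst (T w')" "int n dvd snd (T w) - snd (T w')"
    obtain v d v' d' where wv: "w = (v, d)" "w' = (v', d')"
      by (cases w; cases w')
    have "d = d'"
      using w eq(2) by (intro eq_of_dvd_diff[of v d v' d']) (simp_all add: wv T_def)
    moreover have "v = v'"
      using eq(1) by (simp add: wv T_def split: if_splits) (metis qneg_qneg in_cyc_qneg)+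
    ultimately show "w = w'"
      by (simp add: wv)
  qed (use z qneg_Q8 in \<open>auto simp: carrier_G\<close>)
qed

text \<open>The class of \<open>(u, c)\<close> is not an orbit of the automorphism group of the scheme, so this
  matching glues two incompatible partial automorphisms: on \<open>Q8 \<times> P\<close> the one exchanging the cosets
  of \<open>{\<plusminus>1}\<close> outside \<open>\<langle>i\<rangle>\<close> and fixing the rest, elsewhere the one given by \<open>flip\<close>.\<close>

lemma matching_qflip:
  assumes z: "(u, c) \<in> carrier G" and u: "\<not> in_cyc u" and c: "int q dvd c"
  shows "\<exists>\<tau>. matching G (rel q n) (u, c) (qflip u, c) \<tau>"
proof -
  let ?e = "qdiff (qflip u) u"
  define T where "T w = (if \<not> int q dvd snd w then flip w
      else if in_cyc (fst w) then w else (hamilton_mult ?e (fst w), snd w))"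
    for w :: "quaternion \<times> int"
  have uQ: "u \<in> carrier Q8"
    using z by (simp add: carrier_G)
  have e: "?e \<in> carrier Q8" "in_cyc ?e"
    using uQ by (auto intro: hamilton_mult_Q8 qconj_Q8 qflip_Q8 in_cyc_qdiff_qflip)
  show ?thesis
  proof (rule exists_matching[OF z, where T = T])
    fix w assume w: "w \<in> carrier G"
    obtain v d where wv: "w = (v, d)"
      by (cases w)
    have vQ: "v \<in> carrier Q8"
      using w by (simp add: wv carrier_G)
    show "fst (T w) \<in> carrier Q8"
      using vQ e by (simp add: wv T_def qflip_Q8 hamilton_mult_Q8)
    show "w \<sim> T w"
    proof (cases "int q dvd d")
      case True
      then show ?thesis
        using in_cyc_hamilton_mult[OF e(2,1) vQ] by (intro near_imp_sim) (simp add: T_def wv)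
    next
      case False
      then have "T w = flip w"
        by (simp add: T_def wv)
      then show ?thesis by simp
    qed
    show "diff (u, c) w \<sim> diff (qflip u, c) (T w)"
    proof (cases "int q dvd d")
      case True
      \<comment> \<open>For \<open>v\<close> in \<open>\<langle>i\<rangle>\<close> both quotients
        lie outside \<open>\<langle>i\<rangle>\<close> and over \<open>P\<close>, where a class
        contains that whole coset; otherwise left multiplication by \<open>?e\<close> keeps the
        quotient.\<close>
      show ?thesis
      proof (cases "in_cyc v")
        case True
        have "int q dvd c - d"
          using c \<open>int q dvd d\<close> by simp
        then show ?thesis
          using in_cyc_qdiff[OF uQ vQ] in_cyc_qdiff[OF qflip_Q8[OF uQ] vQ] u True \<open>int q dvd d\<close>
          by (intro near_imp_sim) (simp add: T_def wv)
      next
        case False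
        then show ?thesis
          using qdiff_qflip_rotate[OF uQ vQ u] \<open>int q dvd d\<close> by (simp add: T_def wv)
      qed
    next
      case False
      \<comment> \<open>The second components differ by \<open>2 * c\<close>, an element of
        \<open>P\<close>, and \<open>d - c\<close> lies outside \<open>P\<close>, so the class
        absorbs the error.\<close>
      have "\<not> int q dvd d - c"
        using False c by (metis dvd_diff_left_iff dvd_diff_commute dvd_diff_right_iff)
      moreover have "int q dvd (d - c) - (c + d)"
        using c by simp
      ultimately have "flip (diff (u, c) w) \<approx> diff (qflip u, c) (T w)"
        using False by (simp add: T_def wv qdiff_qflip)
      then show ?thesis
        by (simp add: sim_def)
    qed
  next
    fix w w' assume w: "w \<in> carrier G" "w' \<in> carrier G"
      and eq: "fst (T w) = fst (T w')" "int n dvd snd (T w) - snd (T w')"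
    obtain v d v' d' where wv: "w = (v, d)" "w' = (v', d')"
      by (cases w; cases w')
    have Q: "v \<in> carrier Q8" "v' \<in> carrier Q8"
      using w by (auto simp: wv carrier_G)
    have "int q dvd snd (T w) - snd (T w')"
      using eq(2) int_q_dvd dvd_trans by blast
    then have "int q dvd snd (T w) \<longleftrightarrow> int q dvd snd (T w')"
      by (rule dvd_iff_of_dvd_diff)
    then have P: "int q dvd d \<longleftrightarrow> int q dvd d'"
      by (auto simp: T_def wv split: if_splits)
    have "int n dvd d - d'"
      using eq(2) P dvd_diff_commute[of "int n" d d'] by (auto simp: T_def wv split: if_splits)
    then have "d = d'"
      using w by (intro eq_of_dvd_diff[of v d v' d']) (simp_all add: wv)
    have "hamilton_mult ?e v = hamilton_mult ?e v' \<Longrightarrow> v = v'"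
      using group.inj_on_cmult[OF group_Q8 e(1)] Q by (simp add: inj_on_def mult_Q8)
    moreover have "in_cyc (hamilton_mult ?e x) \<longleftrightarrow> in_cyc x" if "x \<in> carrier Q8" for x
      using in_cyc_hamilton_mult[OF e(2,1) that] .
    ultimately have "v = v'"
      using eq(1) P Q \<open>d = d'\<close>
      by (simp add: T_def wv split: if_splits) (metis qflip_qflip)+
    then show "w = w'"
      using \<open>d = d'\<close> by (simp add: wv)
  qed (use z qflip_Q8 in \<open>auto simp: carrier_G\<close>)
qed

text \<open>Outside \<open>P\<close>, a shift by \<open>P\<close> is followed by a possible sign
  change. Over \<open>P\<close> the second component is fixed, and sign changes with
  \<open>qflip\<close> connect the four quaternions outside
  \<open>\<langle>i\<rangle>\<close>.\<close>

lemma matching_near: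
  assumes z: "z \<in> carrier G" "z' \<in> carrier G" and near: "z \<approx> z'"
  shows "\<exists>\<tau>. matching G (rel q n) z z' \<tau>"
proof -
  obtain u c u' c' where zu: "z = (u, c)" "z' = (u', c')"
    by (cases z; cases z')
  note trans = matching_trans[OF equiv_rel]
  have id: "\<exists>\<tau>. matching G (rel q n) z z \<tau>" if "z \<in> carrier G" for z
    using that by (intro exists_matching[where T = id]) (auto dest: eq_of_dvd_diff simp del: carrier_DirProd, auto)
  have Q: "u \<in> carrier Q8" "u' \<in> carrier Q8"
    using z by (auto simp: zu carrier_G)
  have neg: "\<exists>\<tau>. matching G (rel q n) (u, c) (u', c) \<tau>"
    if "(u, c) \<in> carrier G" "u' = u \<or> (\<not> in_cyc u \<and> u' = qneg u)" for u c u'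
    using that id matching_qneg by blast
  show ?thesis
  proof (cases "int q dvd c")
    case True
    then have "c' = c"
      using near z by (auto simp: zu intro!: eq_of_dvd_diff[of u c u' c', symmetric])
    show ?thesis
    proof (cases "in_cyc u")
      case True
      then show ?thesis
        using near id z by (auto simp: zu \<open>c' = c\<close>)
    next
      case False
      then have "\<not> in_cyc u'"
        using near by (simp add: zu)
      then consider "u' = u \<or> u' = qneg u" | "u' = qflip u \<or> u' = qneg (qflip u)"
        using not_in_cyc_cases[OF Q False] by blast
      then show ?thesis
      proof cases
        case 1
        then show ?thesis
          using neg z False by (auto simp: zu \<open>c' = c\<close>)
      next
        case 2
        have "(qflip u, c) \<in> carrier G"
          using z qflip_Q8 by (auto simp: zu carrier_G)
        then have "\<exists>\<tau>. matching G (rel q n) (qflip u, c) (u', c) \<tau>"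
          using neg 2 False by auto
        moreover have "\<exists>\<tau>. matching G (rel q n) (u, c) (qflip u, c) \<tau>"
          using matching_qflip z False True by (simp add: zu)
        ultimately show ?thesis
          unfolding zu \<open>c' = c\<close> using trans by blast
      qed
    qed
  next
    case False
    have "(u, c') \<in> carrier G"
      using z by (auto simp: zu carrier_G)
    then have "\<exists>\<tau>. matching G (rel q n) (u, c') (u', c') \<tau>"
      using near False by (intro neg) (auto simp: zu)
    moreover have "\<exists>\<tau>. matching G (rel q n) (u, c) (u, c') \<tau>"
      using matching_shift z near False \<open>(u, c') \<in> carrier G\<close> by (simp add: zu)
    ultimately show ?thesis
      unfolding zu using trans by blast
  qed
qed

lemma matching_rel:
  assumes "(z, z') \<in> rel q n"
  shows "\<exists>\<tau>. matching G (rel q n) z z' \<tau>"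
proof -
  have z: "z \<in> carrier G" "z' \<in> carrier G" "z \<sim> z'"
    using assms by (auto simp: rel_def)
  from z(3) consider "z \<approx> z'" | "flip z \<approx> z'"
    unfolding sim_def by blast
  then show ?thesis
  proof cases
    case 2
    obtain u c where zu: "z = (u, c)"
      by (cases z)
    let ?z = "(qflip u, (- c) mod int n)"
    have "?z \<in> carrier G"
      using z by (intro mod_closed) (simp add: zu carrier_G qflip_Q8)
    moreover have "?z \<approx> z'"
      using 2 near_trans[OF near_sym[OF near_mod[OF int_q_dvd]]] by (simp add: zu)
    ultimately have "\<exists>\<tau>. matching G (rel q n) ?z z' \<tau>"
      using z(2) by (intro matching_near)
    moreover have "\<exists>\<tau>. matching G (rel q n) z ?z \<tau>"
      using matching_flip z(1) by (simp add: zu)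
    ultimately show ?thesis
      using matching_trans[OF equiv_rel] by blast
  qed (use z matching_near in blast)
qed

section \<open>The partition yields an S-ring\<close>

lemma sim_one_iff:
  assumes "w \<in> carrier G"
  shows "((1, 0, 0, 0), 0) \<sim> w \<longleftrightarrow> w = ((1, 0, 0, 0), 0)"
proof -
  obtain v d where wv: "w = (v, d)"
    by (cases w)
  have "((1, 0, 0, 0), 0) \<sim> w \<longleftrightarrow> v = (1, 0, 0, 0) \<and> int q dvd d \<and> int n dvd d"
    by (auto simp: sim_def wv)
  also have "\<dots> \<longleftrightarrow> v = (1, 0, 0, 0) \<and> d = 0"
    using int_q_dvd assms n_pos eq_of_dvd_diff[of v d v 0] by (auto simp: wv carrier_G)
  finally show ?thesis
    by (simp add: wv)
qed

lemma is_S_ring_rel: "is_S_ring G (int_span (simple_quantity ` (carrier G // rel q n)))"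
proof (rule group.is_S_ring_int_span[OF group_G finite_G equiv_rel])
  have one: "\<one>\<^bsub>G\<^esub> = ((1, 0, 0, 0), 0)"
    by (simp add: one_Q8)
  then have "((1, 0, 0, 0), 0) \<in> carrier G"
    using group.is_monoid[OF group_G] monoid.one_closed by metis
  then show "rel q n `` {\<one>\<^bsub>G\<^esub>} = {\<one>\<^bsub>G\<^esub>}"
    unfolding one by (auto simp: rel_def sim_one_iff)
  fix x y assume xy: "(x, y) \<in> rel q n"
  then show "\<exists>\<tau>. matching G (rel q n) x y \<tau>"
    by (rule matching_rel)
  have xy': "x \<in> carrier G" "y \<in> carrier G" "x \<sim> y"
    using xy by (auto simp: rel_def)
  obtain u c u' c' where xu: "x = (u, c)" "y = (u', c')"
    by (cases x; cases y)
  have "(qconj u, - c) \<sim> (qconj u', - c')"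
    using xy'(3) unfolding xu by (rule sim_qconj)
  then show "(inv\<^bsub>G\<^esub> x, inv\<^bsub>G\<^esub> y) \<in> rel q n"
    using xy' qconj_Q8 n_pos by (simp add: inv_G rel_def xu sim_mod_iff[OF int_q_dvd])
qed

section \<open>Non-schurity by following flips around a cycle\<close>

text \<open>The hypotheses say that negation moves \<open>1\<close> modulo \<open>q\<close> and
  moves the element \<open>q\<close> of \<open>P\<close> modulo \<open>n\<close>, so that both flips
  can be detected.\<close>

lemma not_schurian_rel:
  assumes q2: "\<not> int q dvd 2" and n2: "\<not> int n dvd 2 * int q"
  shows "\<not> schurian G (int_span (simple_quantity ` (carrier G // rel q n)))"
proof
  assume "schurian G (int_span (simple_quantity ` (carrier G // rel q n)))"
  then obtain K where KB: "K \<subseteq> Bij (carrier G)"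
    and K: "\<And>g a b. g \<in> K \<Longrightarrow> a \<in> carrier G \<Longrightarrow> b \<in> carrier G \<Longrightarrow>
      (b \<otimes>\<^bsub>G\<^esub> inv\<^bsub>G\<^esub> a, g b \<otimes>\<^bsub>G\<^esub> inv\<^bsub>G\<^esub> (g a)) \<in> rel q n"
    and trans: "\<And>x y. (x, y) \<in> rel q n \<Longrightarrow> \<exists>g\<in>K. g \<one>\<^bsub>G\<^esub> = \<one>\<^bsub>G\<^esub> \<and> g x = y"
    using group.schurian_int_spanE[OF group_G finite_G equiv_rel] by blast
  define one where "one = ((1, 0, 0, 0) :: quaternion)"
  define i where "i = ((0, 1, 0, 0) :: quaternion)"
  define j where "j = ((0, 0, 1, 0) :: quaternion)"
  note defs = one_def i_def j_def
  have "q \<noteq> n"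
    using n2 by auto
  then have "q < n"
    using q_dvd_n n_pos by (meson dvd_imp_le le_neq_implies_less)
  have q1: "\<not> int q dvd 1"
    using q2 by (meson dvd_trans one_dvd)
  have Q8: "one \<in> carrier Q8" "i \<in> carrier Q8" "j \<in> carrier Q8"
    by (simp_all add: defs Q8_def)
  have "1 < n"
    using \<open>q < n\<close> q_dvd_n n_pos by (cases "q = 0") auto
  then have closed: "(one, 0) \<in> carrier G" "(one, 1) \<in> carrier G" "(one, int q) \<in> carrier G"
    "(i, 0) \<in> carrier G" "(j, 0) \<in> carrier G" "(j, int q) \<in> carrier G"
    "(j, (- int q) mod int n) \<in> carrier G"
    using Q8 n_pos \<open>q < n\<close> by (auto simp: carrier_G)
  have "flip (j, int q) \<approx> (j, - int q)"
    by (simp add: j_def)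
  then have "((j, int q), (j, (- int q) mod int n)) \<in> rel q n"
    using closed by (simp add: rel_def sim_mod_iff[OF int_q_dvd]) (simp add: sim_def)
  then obtain g where g: "g \<in> K" "g (one, 0) = (one, 0)"
    and gj: "g (j, int q) = (j, (- int q) mod int n)"
    using trans[of "(j, int q)" "(j, (- int q) mod int n)"] unfolding one_def
    by (metis one_DirProd one_Q8 one_integer_mod_group)
  have g_closed: "g a \<in> carrier G" if "a \<in> carrier G" for a
    using KB g(1) that by (auto simp: Bij_def bij_betw_def)
  have sim: "diff b a \<sim> diff (g b) (g a)" if "a \<in> carrier G" "b \<in> carrier G" for a b
    using K[OF g(1) that] diff_rel_iff that g_closed by blast
  have sim1: "b \<sim> g b" if "b \<in> carrier G" for b
  proof -
    have "diff b (one, 0) = b" for b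
      by (cases b) (auto simp: one_def)
    then show ?thesis
      using sim[OF closed(1) that] g(2) by simp
  qed
  obtain v1 d1 where 1: "g (one, int q) = (v1, d1)"
    by (cases "g (one, int q)")
  have v1: "v1 = one"
    using sim1[OF closed(3)] unfolding 1 by (auto simp: sim_def one_def)
  \<comment> \<open>The class of \<open>(j, 0)\<close> has second component zero, so
    \<open>g\<close> sends \<open>(one, int q)\<close> to the point over \<open>-q\<close>: it flips
    \<open>P\<close>.\<close>
  have "(j, 0) \<sim> (j, (- int q) mod int n - d1)"
    using sim[OF closed(3,6)] unfolding 1 v1 gj diff.simps by (simp add: defs)
  then have d1: "int n dvd (- int q) mod int n - d1"
    using dvd_diff_commute[of "int n" d1 "(- int q) mod int n"] by (auto simp: sim_def j_def)
  obtain v2 d2 where 2: "g (j, 0) = (v2, d2)"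
    by (cases "g (j, 0)")
  have "(j, 0) \<sim> (v2, d2)"
    using sim1[OF closed(5)] by (simp add: 2)
  then have "int n dvd d2"
    by (auto simp: sim_def j_def)
  then have d2: "d2 = 0"
    using eq_of_dvd_diff[of v2 d2 j 0] g_closed[OF closed(5)] closed(5) by (simp add: 2)
  \<comment> \<open>Classes over \<open>one\<close> stay over \<open>one\<close>, which forces
    \<open>g\<close> to fix \<open>(j, 0)\<close>.\<close>
  have "(one, int q) \<sim> (qdiff j v2, (- int q) mod int n - d2)"
    using sim[OF closed(5,6)] unfolding 2 gj diff.simps by (simp add: defs)
  then have "qdiff j v2 = one"
    by (auto simp: sim_def one_def)
  moreover have "v2 \<in> carrier Q8"
    using g_closed[OF closed(5)] by (simp add: 2)
  ultimately have v2: "v2 = j"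
    by (auto simp: Q8_def defs)
  obtain v3 d3 where 3: "g (one, 1) = (v3, d3)"
    by (cases "g (one, 1)")
  have v3: "v3 = one"
    using sim1[OF closed(2)] unfolding 3 by (auto simp: sim_def one_def)
  \<comment> \<open>The flipped alternative would replace \<open>j\<close> by \<open>k\<close> up to
    sign, so \<open>g\<close> does not flip \<open>C/P\<close>.\<close>
  have "(j, - 1) \<sim> (j, - d3)"
    using sim[OF closed(2,5)] unfolding 2 3 v2 d2 v3 diff.simps by (simp add: defs)
  then have d3: "int q dvd d3 - 1"
    using q1 by (auto simp: sim_def j_def)
  obtain v4 d4 where 4: "g (i, 0) = (v4, d4)"
    by (cases "g (i, 0)")
  have "(i, 0) \<sim> (v4, d4)"
    using sim1[OF closed(4)] by (simp add: 4)
  then have "int n dvd d4" "v4 = i \<or> v4 = qneg i"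
    by (auto simp: sim_def i_def)
  then have d4: "d4 = 0"
    using eq_of_dvd_diff[of v4 d4 i 0] g_closed[OF closed(4)] closed(4) by (simp add: 4)
  have "\<not> int q dvd 1 + d3"
  proof
    assume "int q dvd 1 + d3"
    then have "int q dvd (1 + d3) - (d3 - 1)"
      using d3 by (rule dvd_diff)
    then show False
      using q2 by simp
  qed
  \<comment> \<open>Sending \<open>i\<close> to \<open>-i\<close> would require a flip of
    \<open>C/P\<close>, so \<open>i\<close> is fixed.\<close>
  moreover have "(i, - 1) \<sim> (v4, - d3)"
    using sim[OF closed(2,4)] \<open>v4 = i \<or> v4 = qneg i\<close> unfolding 3 4 v3 d4 diff.simps
    by (auto simp: defs)
  ultimately have v4: "v4 = i"
    by (auto simp: sim_def i_def)
  \<comment> \<open>The class of \<open>(i, - int q)\<close> allows a sign change in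
    \<open>P\<close> only together with one of \<open>i\<close>. Hence \<open>d1\<close> is
    \<open>q\<close> modulo \<open>n\<close>, against the earlier value \<open>-q\<close>.\<close>
  have "(i, - int q) \<sim> (i, - d1)"
    using sim[OF closed(3,4)] unfolding 1 4 v1 v4 d4 diff.simps by (simp add: defs)
  then have "int n dvd - int q + d1"
    by (auto simp: sim_def i_def)
  moreover have "int n dvd (- int q) - (- int q) mod int n"
    by simp
  ultimately have "int n dvd ((- int q) mod int n - d1) + (- int q + d1) + ((- int q) - (- int q) mod int n)"
    using d1 by (blast intro: dvd_add)
  then have "int n dvd - (2 * int q)"
    by (simp add: algebra_simps)
  then show False
    using n2 by (simp only: dvd_minus_iff)
qed

theorem not_Schur_group:
  assumes "\<not> int q dvd 2" and "\<not> int n dvd 2 * int q"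
  shows "\<not> Schur_group G"
  using is_S_ring_rel not_schurian_rel[OF assms] unfolding Schur_group_def by blast

end

theorem lemma5p2:
  fixes p q :: nat
  assumes "prime p" and "odd p" and "prime q" and "odd q"
  shows "\<not> Schur_group (Q8 \<times>\<times> integer_mod_group (p * q))"
proof -
  have not_dvd: "\<not> int r dvd 2" if "prime r" "odd r" for r :: nat
  proof
    assume "int r dvd 2"
    then have "r dvd 2"
      using int_dvd_int_iff[of r 2] by simp
    then have "r = 2"
      using that(1) two_is_prime_nat by (rule primes_dvd_imp_eq[rotated 2])
    then show False
      using that(2) by simp
  qed
  interpret Q8_mod q "p * q"
    using assms by unfold_locales (auto simp: prime_gt_0_nat)
  have "q \<noteq> 0"
    using assms(3) by auto
  \<comment> \<open>Cancelling \<open>q\<close> leaves the claim that \<open>p\<close> does not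
    divide \<open>2\<close>.\<close>
  then have "\<not> int (p * q) dvd 2 * int q"
    using not_dvd[OF assms(1,2)] by simp
  then show ?thesis
    using not_dvd[OF assms(3,4)] by (intro not_Schur_group)
qed

end
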